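(* Let $Q(t)\in\mathbb{H}[t]\setminus\mathbb{C}[t]$ be a monic polynomial of degree $n\ge 1$, written as $Q(t)=f(t)+\mathbf{k}\,g(t)$ with $f(t),g(t)\in\mathbb{C}[t]$, and write $f=f_1+f_2\mathbf{i}$, $g=g_1+g_2\mathbf{i}$ with $f_1,f_2,g_1,g_2\in\mathbb{R}[t]$. Put $D(t)=\gcd(f_1(t),f_2(t),g_1(t),g_2(t))$. Suppose that $Q(t)$ has no real root. Then the following are equivalent: (a) The polynomial $Q(t)$ has a spherical root. (b) $\deg D(t)>0$. (c) $n>\operatorname{rank}\mathcal{B}_{f_1}(f_2,g_1,g_2)$.
   Context: $\mathbb{H}$ is the skew field of real quaternions $x_0+x_1\mathbf{i}+x_2\mathbf{j}+x_3\mathbf{k}$, and $\mathbb{C}=\mathbb{R}+\mathbb{R}\mathbf{i}\subset\mathbb{H}$. In $\mathbb{H}[t]$ the variable $t$ commutes with the coefficients; for $P(t)=a_0t^n+a_1t^{n-1}+\cdots+a_n$ and $q\in\mathbb{H}$ the evaluation is $P(q)=a_0q^n+a_1q^{n-1}+\cdots+a_n$, and $q$ is a root of $P$ if $P(q)=0$. Every $Q\in\mathbb{H}[t]$ is uniquely $f+\mathbf{k}g$ with $f,g\in\mathbb{C}[t]$; for $Q$ monic of degree $n\ge1$ and not in $\mathbb{C}[t]$, $f$ and $g$ are nonzero, $\deg f_1=\deg f=n$, and $f_2,g_1,g_2$ have degree less than $n$. The congruence class of $q\in\mathbb{H}$ is $[q]=\{wqw^{-1}: w\in\mathbb{H}\setminus\{0\}\}=\{q'\in\mathbb{H}:\operatorname{Re}q'=\operatorname{Re}q,\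 |q'|=|q|\}$. A root $q$ of $P\in\mathbb{H}[t]$ is called spherical if $q\notin\mathbb{R}$ and $P(r)=0$ for every $r\in[q]$; otherwise it is called isolated. For a field $F$ of characteristic zero and $P,S\in F[x]$ with $d=\max\{\deg P,\deg S\}$, write $\frac{P(x)S(y)-P(y)S(x)}{x-y}=\sum_{i,j=0}^{d-1}c_{i,j}x^iy^j$; the Bézout matrix is $\operatorname{Bez}(P,S)=(c_{i,j})_{0\le i,j\le d-1}$. For $P,Q_1,\dots,Q_k\in F[x]$ with $\deg Q_j\le\deg P-1$ for all $j$, $\mathcal{B}_P(Q_1,\dots,Q_k)$ is the matrix obtained by stacking $\operatorname{Bez}(P,Q_1),\dots,\operatorname{Bez}(P,Q_k)$ vertically. *)

theory Defs
  imports
    "HOL-Computational_Algebra.Computational_Algebra"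
    "HOL-Computational_Algebra.Field_as_Ring"
    "Jordan_Normal_Form.DL_Rank"
begin

subsection \<open>Quaternions\<close>

codatatype quat = Quat (qRe: real) (qIm1: real) (qIm2: real) (qIm3: real)

lemma quat_eqI [intro?]:
  "qRe p = qRe q \<Longrightarrow> qIm1 p = qIm1 q \<Longrightarrow> qIm2 p = qIm2 q \<Longrightarrow> qIm3 p = qIm3 q \<Longrightarrow> p = q"
  by (rule quat.expand) simp

lemma quat_eq_iff:
  "p = q \<longleftrightarrow> qRe p = qRe q \<and> qIm1 p = qIm1 q \<and> qIm2 p = qIm2 q \<and> qIm3 p = qIm3 q"
  by (auto intro: quat_eqI)

instantiation quat :: ab_group_add
begin

primcorec zero_quat where
  "qRe 0 = 0" | "qIm1 0 = 0" | "qIm2 0 = 0" | "qIm3 0 = 0"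

primcorec plus_quat where
  "qRe (p + q) = qRe p + qRe q"
| "qIm1 (p + q) = qIm1 p + qIm1 q"
| "qIm2 (p + q) = qIm2 p + qIm2 q"
| "qIm3 (p + q) = qIm3 p + qIm3 q"

primcorec uminus_quat where
  "qRe (- p) = - qRe p"
| "qIm1 (- p) = - qIm1 p"
| "qIm2 (- p) = - qIm2 p"
| "qIm3 (- p) = - qIm3 p"

primcorec minus_quat where
  "qRe (p - q) = qRe p - qRe q"
| "qIm1 (p - q) = qIm1 p - qIm1 q"
| "qIm2 (p - q) = qIm2 p - qIm2 q"
| "qIm3 (p - q) = qIm3 p - qIm3 q"

instance
  by standard (simp_all add: quat_eq_iff)

end

instantiation quat :: ring_1
begin

primcorec one_quat where
  "qRe 1 = 1" | "qIm1 1 = 0" | "qIm2 1 = 0" | "qIm3 1 = 0"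

primcorec times_quat where
  "qRe (p * q) = qRe p * qRe q - qIm1 p * qIm1 q - qIm2 p * qIm2 q - qIm3 p * qIm3 q"
| "qIm1 (p * q) = qRe p * qIm1 q + qIm1 p * qRe q + qIm2 p * qIm3 q - qIm3 p * qIm2 q"
| "qIm2 (p * q) = qRe p * qIm2 q - qIm1 p * qIm3 q + qIm2 p * qRe q + qIm3 p * qIm1 q"
| "qIm3 (p * q) = qRe p * qIm3 q + qIm1 p * qIm2 q - qIm2 p * qIm1 q + qIm3 p * qRe q"

instance
  by standard (simp_all add: quat_eq_iff algebra_simps)

end

instantiation quat :: real_algebra_1
begin

primcorec scaleR_quat where
  "qRe (scaleR r q) = r * qRe q"
| "qIm1 (scaleR r q) = r * qIm1 q"
| "qIm2 (scaleR r q) = r * qIm2 q"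
| "qIm3 (scaleR r q) = r * qIm3 q"

instance
  by standard (simp_all add: quat_eq_iff algebra_simps)

end

definition qnorm2 :: "quat \<Rightarrow> real" where
  "qnorm2 q = (qRe q)\<^sup>2 + (qIm1 q)\<^sup>2 + (qIm2 q)\<^sup>2 + (qIm3 q)\<^sup>2"

lemma qnorm2_eq_0_iff: "qnorm2 q = 0 \<longleftrightarrow> q = 0"
  by (auto simp: qnorm2_def quat_eq_iff add_nonneg_eq_0_iff)

instantiation quat :: real_div_algebra
begin

definition inverse_quat :: "quat \<Rightarrow> quat" where
  "inverse q = scaleR (1 / qnorm2 q) (Quat (qRe q) (- qIm1 q) (- qIm2 q) (- qIm3 q))"

definition divide_quat :: "quat \<Rightarrow> quat \<Rightarrow> quat" where
  "divide_quat p q = p * inverse q"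

instance
proof
  fix q :: quat
  assume "q \<noteq> 0"
  then have nz: "qnorm2 q \<noteq> 0"
    by (simp add: qnorm2_eq_0_iff)
  have c: "inverse q = scaleR (1 / qnorm2 q) (Quat (qRe q) (- qIm1 q) (- qIm2 q) (- qIm3 q))"
    by (rule inverse_quat_def)
  have l: "Quat (qRe q) (- qIm1 q) (- qIm2 q) (- qIm3 q) * q = scaleR (qnorm2 q) 1"
    and r: "q * Quat (qRe q) (- qIm1 q) (- qIm2 q) (- qIm3 q) = scaleR (qnorm2 q) 1"
    by (simp_all add: quat_eq_iff qnorm2_def power2_eq_square)
  show "inverse q * q = 1"
    unfolding c mult_scaleR_left l using nz by simp
  show "q * inverse q = 1"
    unfolding c mult_scaleR_right r using nz by simp
next
  fix p q :: quat
  show "p div q = p * inverse q"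
    by (rule divide_quat_def)
next
  show "inverse (0 :: quat) = 0"
    by (simp add: inverse_quat_def quat_eq_iff)
qed

end

definition quat_i :: quat where "quat_i = Quat 0 1 0 0"
definition quat_j :: quat where "quat_j = Quat 0 0 1 0"
definition quat_k :: quat where "quat_k = Quat 0 0 0 1"

lemma quat_units:
  "quat_i * quat_i = -1" "quat_j * quat_j = -1" "quat_k * quat_k = -1"
  "quat_i * quat_j = quat_k" "quat_j * quat_k = quat_i" "quat_k * quat_i = quat_j"
  by (simp_all add: quat_eq_iff quat_i_def quat_j_def quat_k_def)

definition quat_of_complex :: "complex \<Rightarrow> quat" where
  "quat_of_complex z = of_real (Re z) + of_real (Im z) * quat_i"

definition congruence_class :: "quat \<Rightarrow> quat set" where
  "congruence_class q = {w * q * inverse w | w. w \<noteq> 0}"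


subsection \<open>Quaternionic polynomials\<close>

text \<open>
  Polynomials with quaternion coefficients are elements of the type \<open>quat poly\<close>. The library's
  \<^const>\<open>Polynomial.poly\<close> and \<^const>\<open>Polynomial.smult\<close> require commutative coefficients, so evaluation is defined
  separately, with the coefficients on the left of the powers.
\<close>

definition qpoly_eval :: "quat poly \<Rightarrow> quat \<Rightarrow> quat" where
  "qpoly_eval P q = (\<Sum>i\<le>degree P. coeff P i * q ^ i)"

definition qpoly_root :: "quat poly \<Rightarrow> quat \<Rightarrow> bool" where
  "qpoly_root P q \<longleftrightarrow> qpoly_eval P q = 0"

definition spherical_root :: "quat poly \<Rightarrow> quat \<Rightarrow> bool" where
  "spherical_root P q \<longleftrightarrow>
     qpoly_root P q \<and> q \<notin> \<real> \<and> (\<forall>r \<in> congruence_class q. qpoly_root P r)"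

definition qpoly_of_cpoly :: "complex poly \<Rightarrow> quat poly" where
  "qpoly_of_cpoly = map_poly quat_of_complex"

definition qpoly_lsmult :: "quat \<Rightarrow> quat poly \<Rightarrow> quat poly" where
  "qpoly_lsmult a = map_poly (\<lambda>c. a * c)"

definition cpoly_of_rpoly :: "real poly \<Rightarrow> complex poly" where
  "cpoly_of_rpoly = map_poly complex_of_real"


subsection \<open>B\'ezout matrices\<close>

text \<open>
  An element of \<open>'a poly poly\<close> stands for a polynomial in two variables \<open>x\<close> and \<open>y\<close>, where
  \<open>y\<close> is the outer variable: the coefficient of \<open>x\<^sup>i y\<^sup>j\<close> in \<open>B\<close> is \<open>coeff (coeff B j) i\<close>.
\<close>

definition poly_in_x :: "'a::comm_ring_1 poly \<Rightarrow> 'a poly poly" where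
  "poly_in_x P = [:P:]"

definition poly_in_y :: "'a::comm_ring_1 poly \<Rightarrow> 'a poly poly" where
  "poly_in_y P = map_poly (\<lambda>c. [:c:]) P"

definition x_minus_y :: "'a::comm_ring_1 poly poly" where
  "x_minus_y = poly_in_x [:0, 1:] - poly_in_y [:0, 1:]"

definition bezoutian :: "'a::field_char_0 poly \<Rightarrow> 'a poly \<Rightarrow> 'a poly poly" where
  "bezoutian P S =
     (poly_in_x P * poly_in_y S - poly_in_y P * poly_in_x S) div x_minus_y"

text \<open>The division is exact:\<close>

lemma poly_poly_in_y: "poly (poly_in_y P) [:0, 1:] = P"
proof -
  have "poly (poly_in_y P) [:0, 1:] = pcompose P [:0, 1:]"
    unfolding poly_in_y_def pcompose_altdef ..
  then show ?thesis by simp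
qed

lemma bezoutian_mult:
  "bezoutian P S * x_minus_y = poly_in_x P * poly_in_y S - poly_in_y P * poly_in_x S"
proof -
  have eq: "(x_minus_y :: 'a poly poly) = - [:- [:0, 1:], 1:]"
    by (simp add: x_minus_y_def poly_in_x_def poly_in_y_def map_poly_pCons one_pCons)
  have "poly (poly_in_x P * poly_in_y S - poly_in_y P * poly_in_x S) [:0, 1:] = 0"
    by (simp add: poly_poly_in_y) (simp add: poly_in_x_def)
  then have "x_minus_y dvd poly_in_x P * poly_in_y S - poly_in_y P * poly_in_x S"
    unfolding eq minus_dvd_iff by (simp only: poly_eq_0_iff_dvd)
  then show ?thesis
    unfolding bezoutian_def by (rule dvd_div_mult_self)
qed

definition Bez :: "'a::field_char_0 poly \<Rightarrow> 'a poly \<Rightarrow> 'a mat" where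
  "Bez P S =
     (let d = max (degree P) (degree S)
      in mat d d (\<lambda>(i, j). coeff (coeff (bezoutian P S) j) i))"

text \<open>
  Intended for polynomials in the list of degree less than that of \<open>P\<close>, so that all
  blocks are square of size \<open>degree P\<close>; \<^const>\<open>append_rows\<close> needs equal column numbers.
\<close>

definition stacked_Bez :: "'a::field_char_0 poly \<Rightarrow> 'a poly list \<Rightarrow> 'a mat" where
  "stacked_Bez P Qs = foldr (\<lambda>S M. Bez P S @\<^sub>r M) Qs (0\<^sub>m 0 (degree P))"

text \<open>The library's rank is the dimension of the column space inside \<open>K\<^sup>m\<close>, where \<open>m\<close> is the number of rows.\<close>

definition mat_rank :: "'a::field mat \<Rightarrow> nat" where
  "mat_rank A = vec_space.rank (dim_row A) A"

end

theory Submission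
  imports Defs
begin

text \<open>
  Write a quaternion as \<open>a + b U\<close> with \<open>U\<^sup>2 = -1\<close> and put \<open>z = a + b i\<close>. Then
  \<open>Q(a + b U) = R + A U\<close>, where the components of \<open>R\<close> and \<open>A\<close> are the real and imaginary parts of
  \<open>f1(z)\<close>, \<open>f2(z)\<close>, \<open>g2(z)\<close>, \<open>g1(z)\<close>; vanishing for all \<open>U\<close> forces \<open>R = A = 0\<close>, so spherical roots
  are the nonreal common zeros of the four real polynomials.

  For the rank, let polynomials act on sequences by letting the variable act as the shift. If \<open>P\<close>
  annihilates a sequence \<open>u\<close>, the initial segment of \<open>u\<close> lies in the kernel of \<open>Bez(P, S)\<close> iff \<open>S\<close>
  annihilates \<open>u\<close> as well. So the kernel of the stacked matrix is nonzero iff some nonzero sequence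
  is annihilated by all the polynomials, iff they generate a proper ideal.
\<close>

section \<open>Rank and kernel\<close>

text \<open>For distinct columns this is linear dependence of the column set. If columns
  \<open>i\<close> and \<open>j\<close> agree, \<open>unit_vec nc i - unit_vec nc j\<close> lies in
  the kernel, and the rank is at most the number of distinct columns.\<close>

lemma (in vec_space) rank_less_iff_kernel:
  assumes A: "A \<in> carrier_mat n nc"
  shows "rank A < nc \<longleftrightarrow> (\<exists>v \<in> carrier_vec nc. v \<noteq> 0\<^sub>v nc \<and> A *\<^sub>v v = 0\<^sub>v n)"
proof (cases "distinct (cols A)")
  case True
  show ?thesis
    using full_rank_lin_indpt[OF A _ True] lin_indpt_full_rank[OF A True] rank_le_nc[OF A]
      lin_depI[OF A _ _ _ True] lin_depE[OF A _ True]
    by (metis le_neq_implies_less less_irrefl)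
next
  case False
  then obtain i j where ij: "i < nc" "j < nc" "i \<noteq> j" "col A i = col A j"
    using A by (auto simp: distinct_conv_nth)
  let ?v = "unit_vec nc i - unit_vec nc j :: 'a vec"
  have "?v $ i \<noteq> 0" using ij by simp
  then have "?v \<noteq> 0\<^sub>v nc" using ij by (metis index_zero_vec(1))
  moreover have "A *\<^sub>v ?v = A *\<^sub>v unit_vec nc i - A *\<^sub>v unit_vec nc j"
    by (rule mult_minus_distrib_mat_vec[OF A]) auto
  moreover have "A *\<^sub>v unit_vec nc k = col A k" if "k < nc" for k
    using that A by (intro eq_vecI) auto
  then have "A *\<^sub>v unit_vec nc i - A *\<^sub>v unit_vec nc j = 0\<^sub>v n"
    using ij A by (intro eq_vecI) auto
  moreover have "rank A < nc"
  proof -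
    obtain S where S: "maximal S (\<lambda>T. T \<subseteq> set (cols A) \<and> lin_indpt T)"
      using maximal_exists_superset[of "set (cols A)" "\<lambda>T. T \<subseteq> set (cols A) \<and> lin_indpt T" "{}"]
        finite_lin_indpt2[of "{}"] by auto
    then have "card S \<le> card (set (cols A))" by (simp add: card_mono maximal_def)
    also have "\<dots> < nc"
      using False A card_length[of "cols A"] card_distinct[of "cols A"] by (auto simp: le_less)
    finally show ?thesis using rank_card_indpt[OF A S] by simp
  qed
  ultimately show ?thesis by (intro iffI bexI[of _ ?v]) auto
qed

section \<open>Polynomials acting on sequences\<close>

definition seq_apply :: "'a::comm_ring_1 poly \<Rightarrow> (nat \<Rightarrow> 'a) \<Rightarrow> nat \<Rightarrow> 'a" where
  "seq_apply p u m = (\<Sum>j\<le>degree p. coeff p j * u (j + m))"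

lemma seq_apply_altdef:
  assumes "degree p \<le> N"
  shows "seq_apply p u m = (\<Sum>j\<le>N. coeff p j * u (j + m))"
  unfolding seq_apply_def using assms
  by (intro sum.mono_neutral_left) (auto simp: coeff_eq_0)

lemma seq_apply_pCons: "seq_apply (pCons c p) u m = c * u m + seq_apply p u (Suc m)"
proof -
  have "seq_apply (pCons c p) u m = (\<Sum>j\<le>Suc (degree p). coeff (pCons c p) j * u (j + m))"
    by (rule seq_apply_altdef) (rule degree_pCons_le)
  also have "\<dots> = c * u m + seq_apply p u (Suc m)"
    unfolding sum.atMost_Suc_shift seq_apply_def by simp
  finally show ?thesis .
qed

lemma seq_apply_0 [simp]: "seq_apply 0 u m = 0"
  by (simp add: seq_apply_def)

lemma seq_apply_zero_fun [simp]: "seq_apply p (\<lambda>_. 0) m = 0"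
  by (simp add: seq_apply_def)

lemma seq_apply_1 [simp]: "seq_apply 1 u m = u m"
  by (simp add: seq_apply_def)

lemma seq_apply_add: "seq_apply (p + q) u m = seq_apply p u m + seq_apply q u m"
proof -
  let ?N = "max (degree p) (degree q)"
  have "seq_apply (p + q) u m = (\<Sum>j\<le>?N. coeff (p + q) j * u (j + m))"
    by (rule seq_apply_altdef) (rule degree_add_le_max)
  then show ?thesis
    by (simp add: seq_apply_altdef[of _ ?N] sum.distrib algebra_simps)
qed

lemma seq_apply_smult: "seq_apply (Polynomial.smult c p) u m = c * seq_apply p u m"
proof -
  have "seq_apply (Polynomial.smult c p) u m =
      (\<Sum>j\<le>degree p. coeff (Polynomial.smult c p) j * u (j + m))"
    by (rule seq_apply_altdef) (rule degree_smult_le)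
  then show ?thesis by (simp add: seq_apply_def sum_distrib_left mult.assoc)
qed

text \<open>Makes the sequences a module over the polynomials; in the induction \<open>pCons\<close>
  turns multiplication by the variable into a shift.\<close>

lemma seq_apply_mult: "seq_apply (p * q) u m = seq_apply p (seq_apply q u) m"
  by (induction p arbitrary: m)
     (simp_all add: seq_apply_pCons seq_apply_add seq_apply_smult)

lemma seq_apply_dvd_eq_0:
  assumes "d dvd p" "\<And>m. seq_apply d u m = 0"
  shows "seq_apply p u m = 0"
proof -
  obtain k where "p = k * d" using assms(1) by (metis dvdE mult.commute)
  moreover have "seq_apply d u = (\<lambda>_. 0)" using assms(2) by auto
  ultimately show ?thesis by (simp add: seq_apply_mult)
qed

text \<open>The linear recurrence with characteristic polynomial \<open>p\<close> and starting
  values from \<open>v\<close>.\<close>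

function recurrent_seq :: "'a::field poly \<Rightarrow> (nat \<Rightarrow> 'a) \<Rightarrow> nat \<Rightarrow> 'a" where
  "recurrent_seq p v m = (if m < degree p then v m else
     - (\<Sum>j<degree p. coeff p j * recurrent_seq p v (j + (m - degree p))) / lead_coeff p)"
  by auto
termination
  \<comment> \<open>The recursive index is below \<open>m\<close>, as
    \<open>j < degree p \<le> m\<close>.\<close>
  by (relation "measure (\<lambda>(p, v, m). m)") auto

declare recurrent_seq.simps [simp del]

lemma recurrent_seq_initial: "m < degree p \<Longrightarrow> recurrent_seq p v m = v m"
  by (subst recurrent_seq.simps) simp

lemma seq_apply_recurrent_seq:
  assumes "p \<noteq> 0"
  shows "seq_apply p (recurrent_seq p v) m = 0"
proof -
  have "recurrent_seq p v (degree p + m) =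
      - (\<Sum>j<degree p. coeff p j * recurrent_seq p v (j + m)) / lead_coeff p"
    by (subst recurrent_seq.simps) simp
  then show ?thesis
    using assms by (simp add: seq_apply_def lessThan_Suc_atMost[symmetric])
qed

text \<open>By Euclidean division a nonzero element of least degree divides all others. Serves both
  for the annihilator of a sequence and for the real polynomials vanishing at a complex
  point.\<close>

lemma ideal_common_divisor:
  fixes I :: "'a::field_char_0 poly set"
  assumes I: "\<And>h k d. h \<in> I \<Longrightarrow> d \<in> I \<Longrightarrow> h - k * d \<in> I"
    and p: "p \<in> I" "p \<noteq> 0" and proper: "1 \<notin> I"
  shows "\<exists>d. degree d > 0 \<and> (\<forall>h \<in> I. d dvd h)"
proof -
  define d where "d = arg_min degree (\<lambda>h. h \<in> I \<and> h \<noteq> 0)"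
  have d: "d \<in> I" "d \<noteq> 0" and least: "\<And>h. h \<in> I \<Longrightarrow> h \<noteq> 0 \<Longrightarrow> degree d \<le> degree h"
    using arg_min_nat_lemma[of "\<lambda>h. h \<in> I \<and> h \<noteq> 0" p degree] p unfolding d_def by auto
  have dvd: "d dvd h" if "h \<in> I" for h
  proof -
    have "h mod d \<in> I"
      using I[OF that d(1), of "h div d"] by (simp add: minus_div_mult_eq_mod)
    then have "h mod d = 0"
      using least[of "h mod d"] degree_mod_less[OF d(2), of h] by fastforce
    then show ?thesis by (simp add: mod_eq_0_iff_dvd)
  qed
  have "degree d > 0"
  proof (rule ccontr)
    assume "\<not> degree d > 0"
    then obtain k where "1 = k * d"
      using d(2) by (metis dvdE is_unit_iff_degree mult.commute neq0_conv)
    \<comment> \<open>First \<open>d - 1 * d = 0\<close>, then \<open>0 - (- k) * d = 1\<close>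
      would lie in \<open>I\<close>.\<close>
    then show False using I[OF I[OF d(1) d(1), of 1] d(1), of "- k"] proper by simp
  qed
  with dvd show ?thesis by blast
qed

section \<open>The kernel of a B\'ezout matrix\<close>

context
  fixes P S :: "'a::field_char_0 poly"
begin

text \<open>Compare the coefficients of \<open>x^(i+1) y^(j+1)\<close>, \<open>x^(i+1)\<close> and
  \<open>y^(j+1)\<close> in \<open>(x - y) B(x, y) = P(x) S(y) - P(y) S(x)\<close>.\<close>

lemma bezoutian_coeffs:
  shows bezoutian_coeff_Suc_Suc: "coeff (coeff (bezoutian P S) (Suc j)) i =
      coeff (coeff (bezoutian P S) j) (Suc i)
      + coeff P (Suc i) * coeff S (Suc j) - coeff P (Suc j) * coeff S (Suc i)"
    and bezoutian_coeff_Suc_0: "coeff (coeff (bezoutian P S) 0) i =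
      coeff P (Suc i) * coeff S 0 - coeff P 0 * coeff S (Suc i)"
    and bezoutian_coeff_0_Suc: "coeff (coeff (bezoutian P S) j) 0 =
      coeff P (Suc j) * coeff S 0 - coeff P 0 * coeff S (Suc j)"
proof -
  have xy: "x_minus_y = [:[:0, 1:], - 1 :: 'a poly:]"
    by (simp add: x_minus_y_def poly_in_x_def poly_in_y_def map_poly_pCons one_pCons)
  have l: "coeff (coeff (bezoutian P S * x_minus_y) j) i =
      coeff (pCons 0 (coeff (bezoutian P S) j)) i - coeff (coeff (pCons 0 (bezoutian P S)) j) i" for i j
    unfolding xy by (simp add: mult_pCons_right coeff_pCons split: nat.split)
  have r: "coeff (coeff (poly_in_x P * poly_in_y S - poly_in_y P * poly_in_x S) j) i =
      coeff P i * coeff S j - coeff P j * coeff S i" for i j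
    by (simp add: poly_in_x_def poly_in_y_def coeff_map_poly mult.commute)
  have eq: "coeff (pCons 0 (coeff (bezoutian P S) j)) i - coeff (coeff (pCons 0 (bezoutian P S)) j) i
      = coeff P i * coeff S j - coeff P j * coeff S i" for i j
    unfolding l[symmetric] r[symmetric] bezoutian_mult ..
  show "coeff (coeff (bezoutian P S) (Suc j)) i = coeff (coeff (bezoutian P S) j) (Suc i)
      + coeff P (Suc i) * coeff S (Suc j) - coeff P (Suc j) * coeff S (Suc i)"
    using eq[of "Suc j" "Suc i"] by (simp add: algebra_simps)
  show "coeff (coeff (bezoutian P S) 0) i = coeff P (Suc i) * coeff S 0 - coeff P 0 * coeff S (Suc i)"
    using eq[of 0 "Suc i"] by simp
  show "coeff (coeff (bezoutian P S) j) 0 = coeff P (Suc j) * coeff S 0 - coeff P 0 * coeff S (Suc j)"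
    using eq[of "Suc j" 0] by (simp add: algebra_simps)
qed

text \<open>Coefficient of \<open>x^i\<close> in the Bezoutian after replacing \<open>y^j\<close> by
  \<open>u (j + m)\<close>. If \<open>degree S \<le> degree P\<close>, then for \<open>m = 0\<close>
  and \<open>i < degree P\<close> it is row \<open>i\<close> of \<open>Bez P S\<close> times the
  initial segment of \<open>u\<close>.\<close>

definition bez_apply :: "(nat \<Rightarrow> 'a) \<Rightarrow> nat \<Rightarrow> nat \<Rightarrow> 'a" where
  "bez_apply u m i = (\<Sum>j\<le>degree P. coeff (coeff (bezoutian P S) j) i * u (j + m))"

context
  assumes degS: "degree S \<le> degree P"
begin

text \<open>Walk along the antidiagonal to \<open>j = 0\<close> if \<open>i\<close> is large, to
  \<open>i = 0\<close> if \<open>j\<close> is large; the correction terms on the way vanish for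
  degree reasons.\<close>

lemma bezoutian_coeff_eq_0:
  assumes "degree P \<le> i \<or> degree P \<le> j"
  shows "coeff (coeff (bezoutian P S) j) i = 0"
proof -
  have x: "coeff (coeff (bezoutian P S) j) i = 0" if "degree P \<le> i" for i j
    using that degS
    by (induction j arbitrary: i) (simp_all add: bezoutian_coeffs coeff_eq_0)
  have y: "coeff (coeff (bezoutian P S) j) i = 0" if "degree P \<le> j" for i j
    using that
  proof (induction i arbitrary: j)
    case 0
    then show ?case using degS by (simp add: bezoutian_coeffs coeff_eq_0)
  next
    case (Suc i)
    then show ?case using degS Suc.IH[of "Suc j"] bezoutian_coeff_Suc_Suc[of j i]
      by (simp add: coeff_eq_0)
  qed
  show ?thesis using assms x y by blast
qed

lemma bez_apply_eq_0: "degree P \<le> i \<Longrightarrow> bez_apply u m i = 0"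
  by (simp add: bez_apply_def bezoutian_coeff_eq_0)

text \<open>
  Apply the functional \<open>y\<^sup>j \<mapsto> u (j + m)\<close> to the identity
  \<open>(x - y) B(x, y) = P(x) S(y) - P(y) S(x)\<close> and compare coefficients of powers of \<open>x\<close>.
\<close>

lemma bez_apply_shift:
  shows "bez_apply u m i = bez_apply u (Suc m) (Suc i)
      + coeff P (Suc i) * seq_apply S u m - coeff S (Suc i) * seq_apply P u m"
    and "bez_apply u (Suc m) 0 = coeff S 0 * seq_apply P u m - coeff P 0 * seq_apply S u m"
proof -
  let ?n = "degree P"
  let ?b = "\<lambda>i j. coeff (coeff (bezoutian P S) j) i"
  \<comment> \<open>With the bound \<open>Suc ?n\<close>, splitting off \<open>j = 0\<close> leaves
    exactly the range of \<open>bez_apply u (Suc m)\<close>.\<close>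
  have PS: "seq_apply P u m = (\<Sum>j\<le>Suc ?n. coeff P j * u (j + m))"
    "seq_apply S u m = (\<Sum>j\<le>Suc ?n. coeff S j * u (j + m))"
    by (rule seq_apply_altdef, use degS in simp)+
  have B: "bez_apply u m i = (\<Sum>j\<le>Suc ?n. ?b i j * u (j + m))"
    by (simp add: bez_apply_def bezoutian_coeff_eq_0)
  show "bez_apply u m i = bez_apply u (Suc m) (Suc i)
      + coeff P (Suc i) * seq_apply S u m - coeff S (Suc i) * seq_apply P u m"
    unfolding PS B unfolding sum.atMost_Suc_shift bez_apply_def
    by (simp add: bezoutian_coeff_Suc_Suc bezoutian_coeff_Suc_0 algebra_simps sum.distrib
        sum_subtractf sum_distrib_left)
  show "bez_apply u (Suc m) 0 = coeff S 0 * seq_apply P u m - coeff P 0 * seq_apply S u m"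
    unfolding PS sum.atMost_Suc_shift bez_apply_def
    by (simp add: bezoutian_coeff_0_Suc algebra_simps sum_subtractf sum_distrib_left)
qed

text \<open>Raising \<open>m\<close> and \<open>i\<close> together changes nothing here, and the
  value is 0 once \<open>i\<close> reaches \<open>degree P\<close>.\<close>

lemma bez_apply_annihilated:
  assumes "\<And>m. seq_apply P u m = 0" "\<And>m. seq_apply S u m = 0"
  shows "bez_apply u m i = 0"
proof -
  have "bez_apply u m i = bez_apply u (m + k) (i + k)" for k
    by (induction k) (simp_all add: bez_apply_shift(1)[of u "m + _" "i + _"] assms)
  from this[of "degree P"] show ?thesis by (simp add: bez_apply_eq_0)
qed

text \<open>Induction on \<open>m\<close>: the last row gives \<open>seq_apply S u m = 0\<close>,
  and then the shift identities carry the vanishing of all rows from \<open>m\<close> to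
  \<open>Suc m\<close>.\<close>

lemma annihilated_of_bez_apply:
  assumes P: "degree P > 0" "\<And>m. seq_apply P u m = 0"
    and B: "\<And>i. bez_apply u 0 i = 0"
  shows "seq_apply S u m = 0"
proof -
  have step: "seq_apply S u m = 0" if "\<And>i. bez_apply u m i = 0" for m
  proof -
    obtain k where k: "degree P = Suc k" using P(1) by (cases "degree P") auto
    \<comment> \<open>In row \<open>k = degree P - 1\<close> the term
      \<open>bez_apply u (Suc m) (Suc k)\<close> is out of range, which leaves only this
      product.\<close>
    have "lead_coeff P * seq_apply S u m = 0"
      using bez_apply_shift(1)[of u m k] that[of k] bez_apply_eq_0[of "Suc k" u "Suc m"] P(2) k
      by simp
    then show ?thesis using P(1) by auto
  qed
  have "bez_apply u m i = 0" for i
  proof (induction m arbitrary: i)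
    case 0
    then show ?case by (rule B)
  next
    case (Suc m)
    then show ?case
      using bez_apply_shift[of u m] step[of m] P(2) by (cases i) auto
  qed
  then show ?thesis by (rule step)
qed

lemma Bez_carrier: "Bez P S \<in> carrier_mat (degree P) (degree P)"
  using degS by (simp add: Bez_def Let_def max_absorb1)

lemma Bez_mult_vec_eq_0_iff:
  "Bez P S *\<^sub>v vec (degree P) u = 0\<^sub>v (degree P) \<longleftrightarrow> (\<forall>i. bez_apply u 0 i = 0)"
proof -
  have "(Bez P S *\<^sub>v vec (degree P) u) $ i = bez_apply u 0 i" if "i < degree P" for i
    using that degS
    by (simp add: Bez_def Let_def max_absorb1 scalar_prod_def bez_apply_def bezoutian_coeff_eq_0
        lessThan_Suc_atMost[symmetric] atLeast0LessThan)
  moreover have "Bez P S *\<^sub>v vec (degree P) u \<in> carrier_vec (degree P)"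
    using Bez_carrier by simp
  ultimately show ?thesis
    by (metis bez_apply_eq_0 eq_vecI carrier_vecD index_zero_vec not_less)
qed

end
end

section \<open>Kernel and rank of the stacked matrix\<close>

lemma stacked_Bez_carrier:
  assumes "\<And>S. S \<in> set Qs \<Longrightarrow> degree S \<le> degree P"
  shows "stacked_Bez P Qs \<in> carrier_mat (length Qs * degree P) (degree P)"
  using assms unfolding stacked_Bez_def
  by (induction Qs) (auto intro!: carrier_append_rows Bez_carrier)

lemma stacked_Bez_mult_vec_eq_0_iff:
  assumes "\<And>S. S \<in> set Qs \<Longrightarrow> degree S \<le> degree P" "v \<in> carrier_vec (degree P)"
  shows "stacked_Bez P Qs *\<^sub>v v = 0\<^sub>v (length Qs * degree P) \<longleftrightarrow>
    (\<forall>S \<in> set Qs. Bez P S *\<^sub>v v = 0\<^sub>v (degree P))"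
  using assms(1)
proof (induction Qs)
  case Nil
  then show ?case by (auto simp: stacked_Bez_def)
next
  case (Cons S Qs)
  have S: "Bez P S \<in> carrier_mat (degree P) (degree P)"
    by (rule Bez_carrier) (use Cons.prems in auto)
  have Qs: "stacked_Bez P Qs \<in> carrier_mat (length Qs * degree P) (degree P)"
    by (rule stacked_Bez_carrier) (use Cons.prems in auto)
  have "stacked_Bez P (S # Qs) *\<^sub>v v = (Bez P S *\<^sub>v v) @\<^sub>v (stacked_Bez P Qs *\<^sub>v v)"
    using mat_mult_append[OF S Qs assms(2)] by (simp add: stacked_Bez_def)
  moreover have "0\<^sub>v (length (S # Qs) * degree P) =
      0\<^sub>v (degree P) @\<^sub>v (0\<^sub>v (length Qs * degree P) :: 'a vec)"
    by (intro eq_vecI) auto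
  ultimately show ?case
    using append_vec_eq[of "Bez P S *\<^sub>v v" "degree P" "0\<^sub>v (degree P)"]
      mult_mat_vec_carrier[OF S assms(2)] Cons by simp
qed

lemma rank_stacked_Bez_less_iff:
  fixes P :: "'a::field_char_0 poly"
  assumes degP: "degree P > 0" and degQs: "\<And>S. S \<in> set Qs \<Longrightarrow> degree S \<le> degree P"
  shows "mat_rank (stacked_Bez P Qs) < degree P \<longleftrightarrow>
    (\<exists>d. degree d > 0 \<and> d dvd P \<and> (\<forall>S \<in> set Qs. d dvd S))"
proof -
  let ?n = "degree P" and ?N = "length Qs * degree P"
  have carrier: "stacked_Bez P Qs \<in> carrier_mat ?N ?n"
    by (rule stacked_Bez_carrier) (rule degQs)
  have "mat_rank (stacked_Bez P Qs) < ?n \<longleftrightarrow>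
      (\<exists>v \<in> carrier_vec ?n. v \<noteq> 0\<^sub>v ?n \<and> stacked_Bez P Qs *\<^sub>v v = 0\<^sub>v ?N)"
    using vec_space.rank_less_iff_kernel[OF carrier] carrier by (simp add: mat_rank_def)
  also have "\<dots> \<longleftrightarrow> (\<exists>d. degree d > 0 \<and> d dvd P \<and> (\<forall>S \<in> set Qs. d dvd S))"
  proof
    assume "\<exists>v \<in> carrier_vec ?n. v \<noteq> 0\<^sub>v ?n \<and> stacked_Bez P Qs *\<^sub>v v = 0\<^sub>v ?N"
    then obtain v where v: "v \<in> carrier_vec ?n" "v \<noteq> 0\<^sub>v ?n"
      and ker: "stacked_Bez P Qs *\<^sub>v v = 0\<^sub>v ?N"
      by blast
    \<comment> \<open>The recurrence extends the kernel vector to a sequence annihilated by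
      \<open>P\<close>.\<close>
    define u where "u = recurrent_seq P (\<lambda>j. v $ j)"
    have vu: "v = vec ?n u"
      using v(1) by (auto simp: u_def recurrent_seq_initial intro!: eq_vecI)
    have P0: "seq_apply P u m = 0" for m
      unfolding u_def by (rule seq_apply_recurrent_seq) (use degP in auto)
    have Qs0: "seq_apply S u m = 0" if "S \<in> set Qs" for S m
    proof (rule annihilated_of_bez_apply[OF degQs[OF that] degP P0])
      show "bez_apply P S u 0 i = 0" for i
        using ker that stacked_Bez_mult_vec_eq_0_iff[OF degQs v(1)]
          Bez_mult_vec_eq_0_iff[OF degQs[OF that]] vu by auto
    qed
    have "u \<noteq> (\<lambda>_. 0)" using v(2) vu by (auto simp: zero_vec_def)
    \<comment> \<open>The annihilator of \<open>u\<close>: an ideal, proper because \<open>u\<close>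
      is nonzero.\<close>
    define I where "I = {h. \<forall>m. seq_apply h u m = 0}"
    have one: "1 \<notin> I" using \<open>u \<noteq> (\<lambda>_. 0)\<close> by (auto simp: I_def)
    have diff: "h - k * d \<in> I" if "h \<in> I" "d \<in> I" for h k d
      using that seq_apply_add[of h "- k * d" u] seq_apply_dvd_eq_0[of d "- k * d" u]
      by (auto simp: I_def)
    have PI: "P \<in> I" using P0 by (simp add: I_def)
    have P_nz: "P \<noteq> 0" using degP by auto
    obtain d where "degree d > 0" "\<forall>h \<in> I. d dvd h"
      using ideal_common_divisor[OF diff PI P_nz one] by blast
    moreover have "S \<in> I" if "S \<in> set Qs" for S using Qs0[OF that] by (simp add: I_def)
    ultimately show "\<exists>d. degree d > 0 \<and> d dvd P \<and> (\<forall>S \<in> set Qs. d dvd S)"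
      using PI by blast
  next
    assume "\<exists>d. degree d > 0 \<and> d dvd P \<and> (\<forall>S \<in> set Qs. d dvd S)"
    then obtain d where d: "degree d > 0" "d dvd P" "\<And>S. S \<in> set Qs \<Longrightarrow> d dvd S" by blast
    \<comment> \<open>Any sequence annihilated by \<open>d\<close> with nonzero initial segment
      serves; since \<open>degree d > 0\<close>, the first term here is the starting value
      1.\<close>
    define u where "u = recurrent_seq d (\<lambda>_. 1)"
    have d0: "seq_apply d u m = 0" for m
      unfolding u_def by (rule seq_apply_recurrent_seq) (use d(1) in auto)
    have "vec ?n u $ 0 = 1" using degP d(1) by (simp add: u_def recurrent_seq_initial)
    then have "vec ?n u \<noteq> 0\<^sub>v ?n"
      using degP by (metis index_zero_vec(1) zero_neq_one)
    moreover have "Bez P S *\<^sub>v vec ?n u = 0\<^sub>v ?n" if "S \<in> set Qs" for S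
      using Bez_mult_vec_eq_0_iff[OF degQs[OF that]] bez_apply_annihilated[OF degQs[OF that]]
        seq_apply_dvd_eq_0[OF _ d0] d that by blast
    ultimately show "\<exists>v \<in> carrier_vec ?n. v \<noteq> 0\<^sub>v ?n \<and> stacked_Bez P Qs *\<^sub>v v = 0\<^sub>v ?N"
      using stacked_Bez_mult_vec_eq_0_iff[OF degQs, of Qs "vec ?n u"]
      by (intro bexI[of _ "vec ?n u"]) auto
  qed
  finally show ?thesis .
qed

section \<open>Evaluation of quaternionic polynomials\<close>

lemma quat_of_real_sel [simp]:
  "qRe (of_real r) = r" "qIm1 (of_real r) = 0" "qIm2 (of_real r) = 0" "qIm3 (of_real r) = 0"
  by (simp_all add: of_real_def)

lemma quat_sum_sel:
  "qRe (sum h A) = (\<Sum>i\<in>A. qRe (h i))" "qIm1 (sum h A) = (\<Sum>i\<in>A. qIm1 (h i))"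
  "qIm2 (sum h A) = (\<Sum>i\<in>A. qIm2 (h i))" "qIm3 (sum h A) = (\<Sum>i\<in>A. qIm3 (h i))"
  by (induction A rule: infinite_finite_induct; simp)+

text \<open>Over the reals, \<open>1\<close> and \<open>U\<close> span a copy of the complex
  numbers.\<close>

lemma quat_imaginary_unit_power:
  fixes U :: quat
  assumes "U * U = - 1"
  shows "(of_real a + b *\<^sub>R U) ^ i =
    of_real (Re (Complex a b ^ i)) + Im (Complex a b ^ i) *\<^sub>R U"
proof (induction i)
  case (Suc i)
  show ?case
    unfolding power_Suc Suc.IH
    using assms by (simp add: of_real_def algebra_simps)
qed (simp add: of_real_def)

text \<open>Taking \<open>\<phi>\<close> to be \<open>Re\<close> or \<open>Im\<close> gives the two
  quaternions in \<open>R + A U\<close>.\<close>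

definition quat_poly_value :: "(complex \<Rightarrow> real) \<Rightarrow> real poly \<Rightarrow> real poly \<Rightarrow> real poly \<Rightarrow> real poly \<Rightarrow>
    complex \<Rightarrow> quat" where
  "quat_poly_value \<phi> p0 p1 p2 p3 z =
    Quat (\<phi> (poly (cpoly_of_rpoly p0) z)) (\<phi> (poly (cpoly_of_rpoly p1) z))
      (\<phi> (poly (cpoly_of_rpoly p2) z)) (\<phi> (poly (cpoly_of_rpoly p3) z))"

lemma poly_cpoly_of_rpoly_altdef:
  assumes "degree p \<le> N"
  shows "poly (cpoly_of_rpoly p) z = (\<Sum>i\<le>N. of_real (coeff p i) * z ^ i)"
proof -
  have "poly (cpoly_of_rpoly p) z = (\<Sum>i\<le>degree p. of_real (coeff p i) * z ^ i)"
    unfolding cpoly_of_rpoly_def poly_altdef by (simp add: coeff_map_poly degree_map_poly)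
  also have "\<dots> = (\<Sum>i\<le>N. of_real (coeff p i) * z ^ i)"
    using assms by (intro sum.mono_neutral_left) (auto simp: coeff_eq_0)
  finally show ?thesis .
qed

text \<open>Real scalars commute with the coefficients, so only the factor \<open>U\<close> stays on
  the right.\<close>

lemma qpoly_eval_imaginary_unit:
  fixes U :: quat
  assumes U: "U * U = - 1"
    and coeffs: "\<And>i. coeff Q i = Quat (coeff p0 i) (coeff p1 i) (coeff p2 i) (coeff p3 i)"
  shows "qpoly_eval Q (of_real a + b *\<^sub>R U) =
    quat_poly_value Re p0 p1 p2 p3 (Complex a b) + quat_poly_value Im p0 p1 p2 p3 (Complex a b) * U"
proof -
  let ?z = "Complex a b"
  have deg: "degree p0 \<le> degree Q" "degree p1 \<le> degree Q" "degree p2 \<le> degree Q"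
    "degree p3 \<le> degree Q"
    using coeffs by (auto intro!: degree_le simp: quat_eq_iff dest!: coeff_eq_0)
  have Re: "(\<Sum>i\<le>degree Q. Re (?z ^ i) *\<^sub>R coeff Q i) = quat_poly_value Re p0 p1 p2 p3 ?z"
    and Im: "(\<Sum>i\<le>degree Q. Im (?z ^ i) *\<^sub>R coeff Q i) = quat_poly_value Im p0 p1 p2 p3 ?z"
    unfolding quat_poly_value_def deg[THEN poly_cpoly_of_rpoly_altdef] quat_eq_iff
    by (simp_all add: quat_sum_sel coeffs mult.commute)
  have "qpoly_eval Q (of_real a + b *\<^sub>R U) =
      (\<Sum>i\<le>degree Q. Re (?z ^ i) *\<^sub>R coeff Q i + (Im (?z ^ i) *\<^sub>R coeff Q i) * U)"
    unfolding qpoly_eval_def quat_imaginary_unit_power[OF U]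
    by (simp add: of_real_def algebra_simps)
  also have "\<dots> = (\<Sum>i\<le>degree Q. Re (?z ^ i) *\<^sub>R coeff Q i)
      + (\<Sum>i\<le>degree Q. Im (?z ^ i) *\<^sub>R coeff Q i) * U"
    by (simp add: sum.distrib sum_distrib_right)
  finally show ?thesis unfolding Re Im .
qed

section \<open>Polar form and congruence classes\<close>

lemma quat_polar:
  assumes "q \<notin> \<real>"
  obtains a b U where "q = of_real a + b *\<^sub>R U" "U * U = - 1" "qRe U = 0" "b \<noteq> 0"
proof -
  \<comment> \<open>\<open>V\<close> is the imaginary part of \<open>q\<close> and \<open>b\<close>
    its norm; as \<open>V * V\<close> is minus \<open>qnorm2 V\<close>, dividing \<open>V\<close> by
    \<open>b\<close> gives a square root of -1.\<close>
  define V where "V = q - of_real (qRe q)"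
  define b where "b = sqrt (qnorm2 V)"
  have V_Re: "qRe V = 0" by (simp add: V_def)
  have "V \<noteq> 0" using assms unfolding V_def by (metis Reals_of_real eq_iff_diff_eq_0)
  then have "qnorm2 V \<noteq> 0" by (simp add: qnorm2_eq_0_iff)
  moreover have "qnorm2 V \<ge> 0" by (simp add: qnorm2_def)
  ultimately have b: "b \<noteq> 0" "qnorm2 V = b * b" by (simp_all add: b_def)
  show ?thesis
  proof
    show "q = of_real (qRe q) + b *\<^sub>R ((1 / b) *\<^sub>R V)" using b(1) by (simp add: V_def)
    have "V * V = (- qnorm2 V) *\<^sub>R 1"
      using V_Re by (simp add: quat_eq_iff qnorm2_def power2_eq_square)
    then have "((1 / b) *\<^sub>R V) * ((1 / b) *\<^sub>R V) = (1 / b * (1 / b)) *\<^sub>R (- (b * b)) *\<^sub>R 1"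
      by (simp add: b(2))
    then show "((1 / b) *\<^sub>R V) * ((1 / b) *\<^sub>R V) = - 1"
      using b(1) by simp
    show "qRe ((1 / b) *\<^sub>R V) = 0" using V_Re by simp
    show "b \<noteq> 0" by (rule b(1))
  qed
qed

lemma quat_conjugate_imaginary_unit:
  fixes U w :: quat
  assumes "U * U = - 1" "w \<noteq> 0"
  shows "(w * U * inverse w) * (w * U * inverse w) = - 1"
proof -
  have "(w * U * inverse w) * (w * U * inverse w) = w * U * (inverse w * w) * U * inverse w"
    by (simp only: mult.assoc)
  also have "\<dots> = w * (U * U) * inverse w" using assms(2) by (simp add: mult.assoc)
  also have "\<dots> = - 1" using assms by simp
  finally show ?thesis .
qed

lemma quat_conjugate_polar:
  fixes U w :: quat
  assumes "w \<noteq> 0"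
  shows "w * (of_real a + b *\<^sub>R U) * inverse w = of_real a + b *\<^sub>R (w * U * inverse w)"
  using assms by (simp add: of_real_def algebra_simps)

text \<open>Conjugation fixes the reals \<open>a\<close> and \<open>b\<close> and moves only
  \<open>U\<close>, so a whole class is covered by varying the imaginary unit.\<close>

lemma congruence_class_polar:
  assumes "U * U = - 1" "r \<in> congruence_class (of_real a + b *\<^sub>R U)"
  obtains U' where "U' * U' = - 1" "r = of_real a + b *\<^sub>R U'"
  using assms quat_conjugate_imaginary_unit quat_conjugate_polar
  unfolding congruence_class_def by blast

text \<open>
  The conjugates of a purely imaginary \<open>U\<close> by \<open>1\<close>, \<open>i\<close>, \<open>j\<close>, \<open>k\<close> sum to zero, so averaging
  \<open>R + A U' = 0\<close> over them isolates \<open>R\<close>.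
\<close>

lemma spherical_root_imp_common_zero:
  assumes coeffs: "\<And>i. coeff Q i = Quat (coeff p0 i) (coeff p1 i) (coeff p2 i) (coeff p3 i)"
    and "spherical_root Q q"
  obtains z where "\<forall>p \<in> {p0, p1, p2, p3}. poly (cpoly_of_rpoly p) z = 0"
proof -
  obtain a b U where q: "q = of_real a + b *\<^sub>R U" and U: "U * U = - 1" "qRe U = 0" "b \<noteq> 0"
    using quat_polar assms(2) unfolding spherical_root_def by blast
  define R A where "R = quat_poly_value Re p0 p1 p2 p3 (Complex a b)"
    and "A = quat_poly_value Im p0 p1 p2 p3 (Complex a b)"
  have root: "R + A * (w * U * inverse w) = 0" if "w \<noteq> 0" for w
  proof -
    have "w * q * inverse w \<in> congruence_class q"
      using that by (auto simp: congruence_class_def)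
    then have "qpoly_eval Q (of_real a + b *\<^sub>R (w * U * inverse w)) = 0"
      using assms(2) quat_conjugate_polar[OF that, of a b U] q
      by (auto simp: spherical_root_def qpoly_root_def)
    then show ?thesis
      using qpoly_eval_imaginary_unit[OF quat_conjugate_imaginary_unit[OF U(1) that] coeffs, of a b]
      by (simp add: R_def A_def)
  qed
  have units: "quat_i \<noteq> 0" "quat_j \<noteq> 0" "quat_k \<noteq> 0"
    by (simp_all add: quat_eq_iff quat_i_def quat_j_def quat_k_def)
  have "U + quat_i * U * inverse quat_i + quat_j * U * inverse quat_j + quat_k * U * inverse quat_k = 0"
    using U(2) by (simp add: quat_eq_iff quat_i_def quat_j_def quat_k_def inverse_quat_def qnorm2_def)
  moreover have "(R + A * x0) + (R + A * x1) + (R + A * x2) + (R + A * x3) =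
      R + R + R + R + A * (x0 + x1 + x2 + x3)" for x0 x1 x2 x3
    by (simp add: algebra_simps)
  ultimately have "R + R + R + R = 0"
    using root[of 1] root[OF units(1)] root[OF units(2)] root[OF units(3)]
    by (metis add_0_right inverse_1 mult_1_left mult_1_right mult_zero_right zero_neq_one)
  then have R: "R = 0" by (simp add: quat_eq_iff)
  \<comment> \<open>For \<open>w = 1\<close> there remains \<open>A * U = 0\<close> with
    \<open>U\<close> nonzero.\<close>
  with root[of 1] U(1) have A: "A = 0" by auto
  from R A show ?thesis
    using that[of "Complex a b"]
    by (simp add: R_def A_def quat_poly_value_def quat_eq_iff complex_eq_iff)
qed

text \<open>Here \<open>R = A = 0\<close>, whatever \<open>U\<close> is. The case
  \<open>b = 0\<close> is included, so that a real common zero yields a real root.\<close>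

lemma common_zero_imp_root:
  assumes coeffs: "\<And>i. coeff Q i = Quat (coeff p0 i) (coeff p1 i) (coeff p2 i) (coeff p3 i)"
    and zero: "\<And>p. p \<in> {p0, p1, p2, p3} \<Longrightarrow> poly (cpoly_of_rpoly p) (Complex a b) = 0"
    and U: "U * U = - 1"
  shows "qpoly_root Q (of_real a + b *\<^sub>R U)"
  using zero unfolding qpoly_root_def qpoly_eval_imaginary_unit[OF U coeffs]
  by (simp add: quat_poly_value_def quat_eq_iff)

lemma common_zero_imp_spherical_root:
  assumes coeffs: "\<And>i. coeff Q i = Quat (coeff p0 i) (coeff p1 i) (coeff p2 i) (coeff p3 i)"
    and zero: "\<And>p. p \<in> {p0, p1, p2, p3} \<Longrightarrow> poly (cpoly_of_rpoly p) (Complex a b) = 0"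
    and b: "b \<noteq> 0"
  shows "spherical_root Q (of_real a + b *\<^sub>R quat_i)"
proof -
  note root = common_zero_imp_root[OF coeffs zero]
  have "of_real a + b *\<^sub>R quat_i \<notin> \<real>"
    using b by (auto simp: Reals_def quat_eq_iff quat_i_def)
  then show ?thesis
    using root quat_units(1) unfolding spherical_root_def
    by (metis congruence_class_polar)
qed

section \<open>Real polynomials inside the complex ones\<close>

lemma cpoly_of_rpoly_linear:
  "cpoly_of_rpoly (p + q) = cpoly_of_rpoly p + cpoly_of_rpoly q"
  "cpoly_of_rpoly (p - q) = cpoly_of_rpoly p - cpoly_of_rpoly q"
  "cpoly_of_rpoly (Polynomial.smult c p) = Polynomial.smult (of_real c) (cpoly_of_rpoly p)"
  "cpoly_of_rpoly (pCons c p) = pCons (of_real c) (cpoly_of_rpoly p)"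
  by (rule poly_eqI; simp add: cpoly_of_rpoly_def coeff_map_poly coeff_pCons split: nat.split)+

lemma cpoly_of_rpoly_mult: "cpoly_of_rpoly (p * q) = cpoly_of_rpoly p * cpoly_of_rpoly q"
proof (induction p)
  case 0
  show ?case by (simp add: cpoly_of_rpoly_def)
next
  case (pCons c p)
  then show ?case by (simp add: cpoly_of_rpoly_linear)
qed

theorem theorem3:
  fixes Q :: "quat poly" and f g :: "complex poly" and f1 f2 g1 g2 D :: "real poly" and n :: nat
  assumes deg: "degree Q = n" "n \<ge> 1"
    and monic: "lead_coeff Q = 1"
    and not_complex: "Q \<notin> range qpoly_of_cpoly"
    and Q_eq: "Q = qpoly_of_cpoly f + qpoly_lsmult quat_k (qpoly_of_cpoly g)"
    and f_eq: "f = cpoly_of_rpoly f1 + Polynomial.smult \<i> (cpoly_of_rpoly f2)"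
    and g_eq: "g = cpoly_of_rpoly g1 + Polynomial.smult \<i> (cpoly_of_rpoly g2)"
    and D_eq: "D = gcd f1 (gcd f2 (gcd g1 g2))"
    and no_real_root: "\<not> (\<exists>q\<in>\<real>. qpoly_root Q q)"
  shows "((\<exists>q. spherical_root Q q) \<longleftrightarrow> degree D > 0) \<and>
         (degree D > 0 \<longleftrightarrow> n > mat_rank (stacked_Bez f1 [f2, g1, g2]))"
proof -
  have q0: "quat_of_complex 0 = 0" by (simp add: quat_of_complex_def quat_eq_iff)
  \<comment> \<open>since \<open>k i = j\<close>, the coefficient of \<open>j\<close> is \<open>g2\<close> and that of \<open>k\<close> is \<open>g1\<close>\<close>
  have coeffs: "coeff Q i = Quat (coeff f1 i) (coeff f2 i) (coeff g2 i) (coeff g1 i)" for i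
    unfolding Q_eq f_eq g_eq qpoly_of_cpoly_def qpoly_lsmult_def cpoly_of_rpoly_def
    by (simp add: coeff_map_poly q0 quat_of_complex_def quat_eq_iff quat_k_def quat_i_def)
  \<comment> \<open>The leading coefficient 1 is real, so it sits in \<open>f1\<close>; hence
    \<open>f1\<close> has degree \<open>n\<close>, which fixes the block size.\<close>
  have lead: "coeff f1 n = 1" and le: "degree f1 \<le> n" "degree f2 \<le> n" "degree g1 \<le> n" "degree g2 \<le> n"
    using monic coeffs deg(1)
    by (auto intro!: degree_le simp: quat_eq_iff dest!: coeff_eq_0)
  have f1: "degree f1 = n" using lead le(1) le_degree[of f1 n] by auto
  then have f1_nz: "f1 \<noteq> 0" using deg by auto
  then have D_nz: "D \<noteq> 0" by (simp add: D_eq)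
  have degD: "degree D > 0 \<longleftrightarrow> (\<exists>d. degree d > 0 \<and> (\<forall>p \<in> {f1, f2, g2, g1}. d dvd p))"
  proof
    assume "degree D > 0"
    moreover have "\<forall>p \<in> {f1, f2, g2, g1}. D dvd p"
      by (auto simp: D_eq intro: dvd_trans[OF gcd_dvd2] gcd_dvd1)
    ultimately show "\<exists>d. degree d > 0 \<and> (\<forall>p \<in> {f1, f2, g2, g1}. d dvd p)" by blast
  next
    assume "\<exists>d. degree d > 0 \<and> (\<forall>p \<in> {f1, f2, g2, g1}. d dvd p)"
    then obtain d where d: "degree d > 0" "d dvd D" by (auto simp: D_eq)
    then show "degree D > 0" using dvd_imp_degree_le[OF d(2) D_nz] by simp
  qed
  have "(\<exists>q. spherical_root Q q) \<longleftrightarrow> degree D > 0"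
  proof
    assume "\<exists>q. spherical_root Q q"
    then obtain z where z: "\<forall>p \<in> {f1, f2, g2, g1}. poly (cpoly_of_rpoly p) z = 0"
      using spherical_root_imp_common_zero[OF coeffs] by metis
    \<comment> \<open>A proper ideal of real polynomials containing all four components.\<close>
    let ?I = "{p. poly (cpoly_of_rpoly p) z = 0}"
    have "1 \<notin> ?I" by (simp add: cpoly_of_rpoly_def)
    moreover have "h - k * d \<in> ?I" if "h \<in> ?I" "d \<in> ?I" for h k d
      using that by (simp add: cpoly_of_rpoly_linear cpoly_of_rpoly_mult)
    moreover have "f1 \<in> ?I" using z by simp
    ultimately obtain d where "degree d > 0" "\<forall>p \<in> ?I. d dvd p"
      using ideal_common_divisor[of ?I f1] f1_nz by metis
    then show "degree D > 0" unfolding degD using z by blast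
  next
    assume D: "degree D > 0"
    then obtain d where d: "degree d > 0" "\<forall>p \<in> {f1, f2, g2, g1}. d dvd p" using degD by blast
    have "degree (cpoly_of_rpoly d) > 0"
      using d(1) by (simp add: cpoly_of_rpoly_def degree_map_poly)
    then have "\<not> constant (poly (cpoly_of_rpoly d))" by (simp add: constant_degree)
    then obtain z where z: "poly (cpoly_of_rpoly d) z = 0"
      using fundamental_theorem_of_algebra by blast
    obtain a b where ab: "z = Complex a b" by (cases z)
    have zero: "poly (cpoly_of_rpoly p) (Complex a b) = 0" if "p \<in> {f1, f2, g2, g1}" for p
      using d(2) that z ab by (auto elim!: dvdE simp: cpoly_of_rpoly_mult)
    note root = common_zero_imp_root[OF coeffs zero quat_units(1)]
    \<comment> \<open>For \<open>b = 0\<close> the root would be the real number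
      \<open>a\<close>.\<close>
    have "b \<noteq> 0" using root no_real_root by auto
    then show "\<exists>q. spherical_root Q q"
      using common_zero_imp_spherical_root[OF coeffs zero] by blast
  qed
  moreover have "degree D > 0 \<longleftrightarrow> n > mat_rank (stacked_Bez f1 [f2, g1, g2])"
    unfolding degD using rank_stacked_Bez_less_iff[of f1 "[f2, g1, g2]"] f1 le deg by auto
  ultimately show ?thesis by blast
qed

end
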